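(* Let $\mathcal{K}$ be a conditionally complete idempotent semifield with completed semiring $\overline{\mathcal{K}}$, let $n\ge1$, and let $C\subset\mathcal{K}^n$. Let $U$ be the set of differences of affine functions $\mathcal{K}^n\to\mathcal{K}$, i.e., of functions $u(x)=(\langle w',x\rangle\oplus d')\ominus(\langle w'',x\rangle\oplus d'')$ with $w',w''\in\mathcal{K}^n$, $d',d''\in\mathcal{K}$. The following assertions are equivalent: (1) $C$ is a convex subset of $\mathcal{K}^n$, and it is closed in the order topology; (2) $C$ is $U$-convex, i.e., for every $y\in\mathcal{K}^n\setminus C$ there exists $u\in U$ such that $u(y)\not\le\sup_{x\in C}u(x)$.
   Context: An idempotent semiring is a semiring $(\mathcal{S},\oplus,\otimes)$ with zero $\mathbf{0}$ (neutral for $\oplus$, absorbing) and unit $\mathbf{1}$ such that $a\oplus a=a$. Its natural order is $a\le b\iff a\oplus b=b$, so $a\oplus b=a\vee b$ and $\mathbf{0}$ is the bottom element. An idempotent semifield is an idempotent semiring whose nonzero elements are invertible for multiplication. An ordered set is conditionally complete if every nonempty subset bounded above has a least upper bound and every nonempty subset bounded below has a greatest lower bound. An idempotent semifield $\mathcal{K}$ is conditionally complete if it is so for its natural order and left and right multiplications by any element preserve sups of nonempty sets bounded above. The completed semiring $\overline{\mathcal{K}}$ is obtained by adjoining to $\mathcal{K}$ a top element $\tau$ with $a\oplus\tau=\tau$, $\mathbf{0}\tau=\tau\mathbf{0}=\mathbf{0}$, and $a\tau=\tau a=\tau$ for $a\ne\mathbf{0}$. Sups of functions values are taken in $\overline{\mathcal{K}}$.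 $\mathcal{K}^n$ has entrywise addition, order and right action of $\mathcal{K}$; $\langle w,x\rangle=\bigoplus_{1\le i\le n}w_ix_i$. For $\nu,\lambda\in\mathcal{K}$, $\nu\ominus\lambda$ is the least $\mu$ such that $\lambda\oplus\mu\ge\nu$ (it exists). $C\subset\mathcal{K}^n$ is convex if $x\alpha\oplus y\beta\in C$ for all $x,y\in C$, $\alpha,\beta\in\mathcal{K}$ with $\alpha\oplus\beta=\mathbf{1}$. Order topology: a net $(x_\ell)_{\ell\in L}$ in a conditionally complete ordered set $S$, bounded from above and below, order converges to $x\in S$ if $x=\inf_{\ell}\sup_{m\ge\ell}x_m=\sup_{\ell}\inf_{m\ge\ell}x_m$. A subset $X\subset S$ is closed for the order topology if the limit of every order converging net with values in $X$ belongs to $X$.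
   Formalization: Added hypothesis: for all ν, λ in K the least μ with λ⊕μ ≥ ν exists (so K is totally ordered). Without it ν⊖λ can be undefined, e.g. (1,0)⊖(0,0) in Z² with a bottom adjoined. Also 0≠1 in K. *)

theory Defs
  imports "HOL-Analysis.Finite_Cartesian_Product" "HOL-Library.Lub_Glb"
begin

section \<open>Idempotent semirings and semifields\<close>

text \<open>Multiplication is not assumed commutative; \<open>0 \<noteq> 1\<close> comes from \<^class>\<open>semiring_1\<close>.
  The order is the natural order of the semiring, so that \<open>a + b\<close> is the supremum of \<open>a\<close> and \<open>b\<close>.\<close>

class idempotent_semiring = semiring_1 + order +
  assumes add_idem: "a + a = a"
    and natural_order: "a \<le> b \<longleftrightarrow> a + b = b"

class idempotent_semifield = idempotent_semiring +
  assumes ex_inverse: "a \<noteq> 0 \<Longrightarrow> \<exists>b. a * b = 1 \<and> b * a = 1"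

class cc_idempotent_semifield = idempotent_semifield + conditionally_complete_lattice +
  assumes mult_Sup_left: "A \<noteq> {} \<Longrightarrow> bdd_above A \<Longrightarrow> c * Sup A = (SUP a\<in>A. c * a)"
    and mult_Sup_right: "A \<noteq> {} \<Longrightarrow> bdd_above A \<Longrightarrow> Sup A * c = (SUP a\<in>A. a * c)"

lemma zero_least: "(0::'a::idempotent_semiring) \<le> a"
  by (simp add: natural_order)

lemma add_least: "a \<le> c \<Longrightarrow> b \<le> c \<Longrightarrow> a + b \<le> (c::'a::idempotent_semiring)"
  by (metis add.assoc natural_order)

lemma add_upper1: "a \<le> a + (b::'a::idempotent_semiring)"
  by (metis add.assoc add_idem natural_order)

lemma add_eq_zero: "a + b = 0 \<longleftrightarrow> a = 0 \<and> b = (0::'a::idempotent_semiring)"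
  by (metis add.commute add.right_neutral add_upper1 natural_order)

lemma mult_eq_zero: "a * b = 0 \<longleftrightarrow> a = 0 \<or> b = (0::'a::idempotent_semifield)"
proof -
  have "b = 0" if ab: "a * b = 0" and a: "a \<noteq> 0"
  proof -
    obtain c where "c * a = 1" using ex_inverse[OF a] by blast
    hence "b = c * (a * b)" by (simp add: mult.assoc[symmetric])
    thus ?thesis using ab by simp
  qed
  thus ?thesis by auto
qed


section \<open>The completed semiring\<close>

datatype 'a completion = Elem 'a | Tau

instantiation completion :: (idempotent_semifield) semiring_1
begin

definition zero_completion :: "'a completion" where "0 = Elem 0"

definition one_completion :: "'a completion" where "1 = Elem 1"

fun plus_completion :: "'a completion \<Rightarrow> 'a completion \<Rightarrow> 'a completion" where
  "Elem a + Elem b = Elem (a + b)"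
| "Tau + y = Tau"
| "x + Tau = Tau"

fun times_completion :: "'a completion \<Rightarrow> 'a completion \<Rightarrow> 'a completion" where
  "Elem a * Elem b = Elem (a * b)"
| "Elem a * Tau = (if a = 0 then Elem 0 else Tau)"
| "Tau * Elem a = (if a = 0 then Elem 0 else Tau)"
| "Tau * Tau = Tau"

instance
proof
  fix a b c :: "'a completion"
  show assoc: "a + b + c = a + (b + c)" for a b c :: "'a completion"
    by (cases a; cases b; cases c) (auto simp: add.assoc)
  show comm: "a + b = b + a" for a b :: "'a completion"
    by (cases a; cases b) (auto simp: add.commute)
  show "0 + a = a" by (cases a) (auto simp: zero_completion_def)
  show "a * b * c = a * (b * c)"
    by (cases a; cases b; cases c) (auto simp: mult.assoc mult_eq_zero)
  show "1 * a = a" "a * 1 = a" by (cases a; auto simp: one_completion_def)+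
  show "0 * a = 0" "a * 0 = 0" by (cases a; auto simp: zero_completion_def)+
  show "(a + b) * c = a * c + b * c"
    by (cases a; cases b; cases c) (auto simp: distrib_right add_eq_zero)
  show "a * (b + c) = a * b + a * c"
    by (cases a; cases b; cases c) (auto simp: distrib_left add_eq_zero)
  show "(0::'a completion) \<noteq> 1" by (simp add: zero_completion_def one_completion_def)
qed

end

instantiation completion :: (idempotent_semifield) order
begin

definition less_eq_completion :: "'a completion \<Rightarrow> 'a completion \<Rightarrow> bool"
  where "x \<le> y \<longleftrightarrow> x + y = (y :: 'a completion)"

definition less_completion :: "'a completion \<Rightarrow> 'a completion \<Rightarrow> bool"
  where "x < y \<longleftrightarrow> x \<le> y \<and> \<not> y \<le> (x :: 'a completion)"

instance
proof
  fix a b c :: "'a completion"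
  show "a < b \<longleftrightarrow> a \<le> b \<and> \<not> b \<le> a" by (simp add: less_completion_def)
  show "a \<le> a" by (cases a) (auto simp: less_eq_completion_def add_idem)
  show "a \<le> b \<Longrightarrow> b \<le> c \<Longrightarrow> a \<le> c" unfolding less_eq_completion_def by (metis add.assoc)
  show "a \<le> b \<Longrightarrow> b \<le> a \<Longrightarrow> a = b" unfolding less_eq_completion_def by (metis add.commute)
qed

end

instance completion :: (idempotent_semifield) idempotent_semiring
proof
  fix a b :: "'a completion"
  show "a + a = a" by (cases a) (auto simp: add_idem)
  show "a \<le> b \<longleftrightarrow> a + b = b" by (simp add: less_eq_completion_def)
qed

lemma le_completion_simps [simp]:
  "x \<le> (Tau :: 'a::idempotent_semifield completion)"
  "Elem a \<le> Elem b \<longleftrightarrow> a \<le> (b::'a)"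
  "\<not> Tau \<le> Elem (b::'a)"
  by (cases x; simp add: less_eq_completion_def natural_order)+

instantiation completion :: (cc_idempotent_semifield) complete_lattice
begin

definition bot_completion :: "'a completion" where "bot = Elem (0::'a)"

definition top_completion :: "'a completion" where "top = (Tau :: 'a completion)"

definition sup_completion :: "'a completion \<Rightarrow> 'a completion \<Rightarrow> 'a completion"
  where "sup x y = x + (y :: 'a completion)"

fun inf_completion :: "'a completion \<Rightarrow> 'a completion \<Rightarrow> 'a completion" where
  "inf (Elem a) (Elem b) = Elem (inf a b)"
| "inf Tau y = y"
| "inf x Tau = x"

definition Sup_completion :: "'a completion set \<Rightarrow> 'a completion" where
  "Sup (X :: 'a completion set) = (if X = {} then Elem 0
            else if Tau \<in> X \<or> \<not> bdd_above {a. Elem a \<in> X} then Tau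
            else Elem (Sup {a. Elem a \<in> X}))"

definition Inf_completion :: "'a completion set \<Rightarrow> 'a completion" where
  "Inf (X :: 'a completion set) = (if X \<subseteq> {Tau} then Tau else Elem (Inf {a. Elem a \<in> X}))"

instance
proof
  fix x y z :: "'a completion" and X :: "'a completion set"
  show "inf x y \<le> x" "inf x y \<le> y"
    by (cases x; cases y; simp)+
  show "x \<le> y \<Longrightarrow> x \<le> z \<Longrightarrow> x \<le> inf y z"
    by (cases x; cases y; cases z; simp)
  show "x \<le> sup x y" unfolding sup_completion_def by (rule add_upper1)
  show "y \<le> sup x y" unfolding sup_completion_def by (metis add_upper1 add.commute)
  show "y \<le> x \<Longrightarrow> z \<le> x \<Longrightarrow> sup y z \<le> x"
    unfolding sup_completion_def by (rule add_least)
  have bb: "bdd_below A" for A :: "'a set"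
    by (meson bdd_below.I zero_least)
  show "Inf X \<le> x" if "x \<in> X"
  proof (cases x)
    case (Elem a)
    thus ?thesis using that by (auto simp: Inf_completion_def intro!: cInf_lower bb)
  qed auto
  show "z \<le> Inf X" if *: "\<And>x. x \<in> X \<Longrightarrow> z \<le> x"
  proof (cases "X \<subseteq> {Tau}")
    case True thus ?thesis by (simp add: Inf_completion_def)
  next
    case False
    then obtain a where a: "Elem a \<in> X" by (metis completion.exhaust singletonI subsetI)
    from *[OF a] obtain c where c: "z = Elem c" by (cases z) auto
    have "c \<le> Inf {a. Elem a \<in> X}"
      using a *[unfolded c] by (intro cInf_greatest) (auto, metis le_completion_simps(2))
    thus ?thesis using False by (simp add: Inf_completion_def c)
  qed
  show "x \<le> Sup X" if "x \<in> X"
    using that by (cases x) (auto simp: Sup_completion_def intro!: cSup_upper)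
  show "Sup X \<le> z" if *: "\<And>x. x \<in> X \<Longrightarrow> x \<le> z"
  proof (cases z)
    case Tau thus ?thesis by simp
  next
    case (Elem c)
    have nt: "Tau \<notin> X" using *[of Tau] Elem by auto
    have le: "a \<le> c" if "Elem a \<in> X" for a using *[OF that] Elem by simp
    have bdd: "bdd_above {a. Elem a \<in> X}" using le by (intro bdd_aboveI) auto
    show ?thesis
    proof (cases "X = {}")
      case True thus ?thesis by (simp add: Sup_completion_def Elem zero_least)
    next
      case False
      then obtain a where "Elem a \<in> X" using nt by (metis completion.exhaust ex_in_conv)
      hence "Sup {a. Elem a \<in> X} \<le> c" using le by (intro cSup_least) auto
      thus ?thesis using False nt bdd by (simp add: Sup_completion_def Elem)
    qed
  qed
  show "Inf {} = (top :: 'a completion)" by (simp add: Inf_completion_def top_completion_def)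
  show "Sup {} = (bot :: 'a completion)" by (simp add: Sup_completion_def bot_completion_def)
qed

end


section \<open>Convexity and differences of affine functions\<close>

text \<open>The right action of the scalars (the library's \<open>*s\<close> is the left action).\<close>

definition rscale :: "'k::times ^ 'n \<Rightarrow> 'k \<Rightarrow> 'k ^ 'n"
  where "rscale x a = (\<chi> i. x $ i * a)"

definition semimodule_convex :: "('k::idempotent_semiring ^ 'n) set \<Rightarrow> bool"
  where "semimodule_convex C \<longleftrightarrow>
    (\<forall>x\<in>C. \<forall>y\<in>C. \<forall>a b. a + b = 1 \<longrightarrow> rscale x a + rscale y b \<in> C)"

text \<open>\<open>LEAST\<close> has its intended meaning only where the least element exists. It does whenever
  the order is total, but not in every conditionally complete idempotent semifield: adjoin a bottom
  element to the lattice-ordered group \<open>\<int> \<times> \<int>\<close>; then the elements \<open>m\<close> such that the supremum of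
  \<open>(0, 0)\<close> and \<open>m\<close> is above \<open>(1, 0)\<close> are the pairs with first component at least \<open>1\<close>, and no such
  pair is least.\<close>

definition ominus :: "'k::idempotent_semiring \<Rightarrow> 'k \<Rightarrow> 'k"  (infixl \<open>\<ominus>\<close> 65)
  where "\<nu> \<ominus> l = (LEAST m. \<nu> \<le> l + m)"

definition pairing :: "'k::idempotent_semiring ^ 'n \<Rightarrow> 'k ^ 'n \<Rightarrow> 'k"
  where "pairing w x = (\<Sum>i\<in>UNIV. w $ i * x $ i)"

definition affine_differences :: "('k::idempotent_semiring ^ 'n \<Rightarrow> 'k) set"
  where "affine_differences =
    {\<lambda>x. (pairing w' x + d') \<ominus> (pairing w'' x + d'') | w' d' w'' d''. True}"

definition U_convex :: "('x \<Rightarrow> 'k::cc_idempotent_semifield) set \<Rightarrow> 'x set \<Rightarrow> bool"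
  where "U_convex U C \<longleftrightarrow>
    (\<forall>y. y \<notin> C \<longrightarrow> (\<exists>u\<in>U. \<not> Elem (u y) \<le> (SUP x\<in>C. Elem (u x))))"


section \<open>Order convergence\<close>

definition directed_set :: "'i set \<Rightarrow> 'i rel \<Rightarrow> bool"
  where "directed_set L r \<longleftrightarrow> L \<noteq> {} \<and> preorder_on L r \<and>
    (\<forall>a\<in>L. \<forall>b\<in>L. \<exists>c\<in>L. (a, c) \<in> r \<and> (b, c) \<in> r)"

text \<open>\<open>r `` {l}\<close> is the set of indices above \<open>l\<close>. Suprema and infima are expressed relationally; on
  a conditionally complete order they exist for all tails of a bounded net (for \<open>\<K>\<^sup>n\<close> see
  \<open>isLub_vec\<close> and \<open>isGlb_vec\<close> below).\<close>

definition order_converges :: "'i set \<Rightarrow> 'i rel \<Rightarrow> ('i \<Rightarrow> 'a::order) \<Rightarrow> 'a \<Rightarrow> bool"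
  where "order_converges L r f x \<longleftrightarrow>
    bdd_above (f ` L) \<and> bdd_below (f ` L) \<and>
    isGlb UNIV {s. \<exists>l\<in>L. isLub UNIV (f ` (r `` {l})) s} x \<and>
    isLub UNIV {t. \<exists>l\<in>L. isGlb UNIV (f ` (r `` {l})) t} x"

text \<open>A definition cannot quantify over the type of indices. Nets indexed by sets of pairs (point,
  set of points) suffice: \<open>order_closedD\<close> below gives closedness under nets with any index type.\<close>

definition order_closed :: "'a::order set \<Rightarrow> bool"
  where "order_closed X \<longleftrightarrow>
    (\<forall>(L :: ('a \<times> 'a set) set) r f x.
      directed_set L r \<longrightarrow> f ` L \<subseteq> X \<longrightarrow> order_converges L r f x \<longrightarrow> x \<in> X)"

lemma order_closedD:
  fixes L :: "'i set" and f :: "'i \<Rightarrow> 'a::order"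
  assumes X: "order_closed X" and L: "directed_set L r" and fX: "f ` L \<subseteq> X"
    and conv: "order_converges L r f x"
  shows "x \<in> X"
proof -
  define T where "T l = f ` (r `` {l})" for l
  define M where "M = {(a, T l) | a l. l \<in> L \<and> a \<in> T l}"
  define q where "q = {((a, S), (b, S')). (a, S) \<in> M \<and> (b, S') \<in> M \<and> S' \<subseteq> S}"
  have re: "(l, l) \<in> r" if "l \<in> L" for l
    using L that by (auto simp: directed_set_def preorder_on_def refl_on_def)
  have tr: "trans r" and sub: "r \<subseteq> L \<times> L"
    using L by (auto simp: directed_set_def preorder_on_def refl_on_def)
  have fT: "f l \<in> T l" if "l \<in> L" for l using re[OF that] by (auto simp: T_def)
  have Tmono: "T m \<subseteq> T l" if "(l, m) \<in> r" for l m
    using that tr by (auto simp: T_def dest: transD)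
  have TL: "T l \<subseteq> f ` L" for l using sub by (auto simp: T_def)
  have dir: "directed_set M q"
    unfolding directed_set_def
  proof (intro conjI ballI)
    from L obtain l where "l \<in> L" by (auto simp: directed_set_def)
    thus "M \<noteq> {}" using fT by (auto simp: M_def)
    show "preorder_on M q"
      by (auto simp: preorder_on_def refl_on_def trans_def q_def)
    fix p p' assume "p \<in> M" "p' \<in> M"
    then obtain a l b m where p: "p = (a, T l)" "p' = (b, T m)" and lm: "l \<in> L" "m \<in> L"
      by (auto simp: M_def)
    then obtain k where k: "k \<in> L" "(l, k) \<in> r" "(m, k) \<in> r"
      using L by (auto simp: directed_set_def)
    hence "(f k, T k) \<in> M" using fT by (auto simp: M_def)
    thus "\<exists>c\<in>M. (p, c) \<in> q \<and> (p', c) \<in> q"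
      using k Tmono p \<open>p \<in> M\<close> \<open>p' \<in> M\<close> by (intro bexI[of _ "(f k, T k)"]) (auto simp: q_def)
  qed
  have tail: "fst ` (q `` {(a, T l)}) = T l" if "l \<in> L" "a \<in> T l" for a l
  proof -
    have "(b, T l) \<in> q `` {(a, T l)}" if "b \<in> T l" for b
      using that \<open>l \<in> L\<close> \<open>a \<in> T l\<close> by (auto simp: q_def M_def)
    hence "T l \<subseteq> fst ` (q `` {(a, T l)})" by force
    moreover have "fst ` (q `` {(a, T l)}) \<subseteq> T l"
      by (auto simp: q_def M_def)
    ultimately show ?thesis by blast
  qed
  have tails: "(\<exists>p\<in>M. P (fst ` (q `` {p}))) \<longleftrightarrow> (\<exists>l\<in>L. P (f ` (r `` {l})))" for P
  proof
    assume "\<exists>p\<in>M. P (fst ` (q `` {p}))"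
    then obtain a l where "l \<in> L" "a \<in> T l" "P (fst ` (q `` {(a, T l)}))"
      by (auto simp: M_def)
    thus "\<exists>l\<in>L. P (f ` (r `` {l}))" using tail by (auto simp: T_def)
  next
    assume "\<exists>l\<in>L. P (f ` (r `` {l}))"
    then obtain l where l: "l \<in> L" "P (T l)" by (auto simp: T_def)
    hence "(f l, T l) \<in> M" "P (fst ` (q `` {(f l, T l)}))"
      using fT tail by (auto simp: M_def)
    thus "\<exists>p\<in>M. P (fst ` (q `` {p}))" by blast
  qed
  have img: "fst ` M = f ` L" using fT TL by (force simp: M_def)
  have "order_converges M q fst x"
    using conv unfolding order_converges_def img
      tails[of "\<lambda>S. isLub UNIV S s" for s] tails[of "\<lambda>S. isGlb UNIV S s" for s] .
  thus ?thesis using X dir fX img unfolding order_closed_def by metis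
qed

lemma isLub_vec:
  fixes X :: "('k::conditionally_complete_lattice ^ 'n) set"
  assumes "X \<noteq> {}" "bdd_above X"
  shows "isLub UNIV X (\<chi> i. SUP x\<in>X. x $ i)"
proof (rule isLubI2)
  obtain B where B: "\<And>x. x \<in> X \<Longrightarrow> x \<le> B" using assms(2) by (auto simp: bdd_above_def)
  hence "bdd_above ((\<lambda>x. x $ i) ` X)" for i by (auto simp: less_eq_vec_def bdd_above_def)
  thus "isUb UNIV X (\<chi> i. SUP x\<in>X. x $ i)"
    by (auto simp: less_eq_vec_def intro!: isUb_UNIV_I cSUP_upper)
  show "(\<chi> i. SUP x\<in>X. x $ i) <=* Collect (isUb UNIV X)"
    using assms(1) by (auto simp: less_eq_vec_def isUb_def setle_def intro!: setgeI cSUP_least)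
qed

lemma isGlb_vec:
  fixes X :: "('k::conditionally_complete_lattice ^ 'n) set"
  assumes "X \<noteq> {}" "bdd_below X"
  shows "isGlb UNIV X (\<chi> i. INF x\<in>X. x $ i)"
proof -
  obtain B where B: "\<And>x. x \<in> X \<Longrightarrow> B \<le> x" using assms(2) by (auto simp: bdd_below_def)
  hence "bdd_below ((\<lambda>x. x $ i) ` X)" for i by (auto simp: less_eq_vec_def bdd_below_def)
  thus ?thesis using assms(1)
    by (auto simp: isGlb_def greatestP_def isLb_def less_eq_vec_def setge_def setle_def
        intro!: cINF_lower cINF_greatest)
qed

end

theory Submission
  imports Defs
begin

text \<open>Existence of all differences forces the order of \<open>\<K>\<close> to be total: if \<open>m\<close> is
  least with \<open>c \<le> 1 + m\<close> and \<open>b = 1 + c\<^sup>-\<^sup>1\<close>, then \<open>(1 + c) b = (1 + c) + b\<close> shows that \<open>m b\<^sup>-\<^sup>1\<close> is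
  another candidate, so that \<open>m = 0\<close> or \<open>b \<le> 1\<close>. Over a totally ordered semifield,
  \<open>U\<close>-convexity means separation of points by half-spaces \<open>f \<le> g\<close> with \<open>f\<close>, \<open>g\<close> affine, and these
  are convex and order closed. Conversely, work with homogeneous coordinates
  \<open>(y, 1)\<close>. For \<open>Y\<close> above \<open>(y, 1)\<close> with nonzero entries and \<open>z\<close> below the \<open>j\<close>-th entry of \<open>(y, 1)\<close>,
  a failure of the half-space
  \<open>z\<^sup>-\<^sup>1 v\<^sub>j \<le> \<Sum>\<^sub>k Y\<^sub>k\<^sup>-\<^sup>1 v\<^sub>k\<close> to contain \<open>C\<close> yields a multiple \<open>v\<close> of a point of \<open>C\<close> with \<open>v \<le> Y\<close> and
  \<open>z < v\<^sub>j\<close>. The sums of such \<open>v\<close> are again multiples of points of \<open>C\<close>, and letting \<open>Y\<close> and \<open>z\<close> vary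
  they come arbitrarily close to \<open>(y, 1)\<close>. Only the semifield \<open>{0, 1}\<close>, where \<open>0\<close> is not the
  infimum of the nonzero elements, needs different half-spaces.\<close>

section \<open>Idempotent semifields\<close>

lemma idem_mult_left_mono: "a \<le> b \<Longrightarrow> c * a \<le> c * (b::'a::idempotent_semiring)"
  by (metis natural_order distrib_left)

lemma idem_mult_right_mono: "a \<le> b \<Longrightarrow> a * c \<le> b * (c::'a::idempotent_semiring)"
  by (metis natural_order distrib_right)

lemma idem_le_zero: "a \<le> 0 \<longleftrightarrow> a = (0::'a::idempotent_semiring)"
  by (metis order.antisym order.refl zero_least)

lemma idem_zero_less: "0 < a \<longleftrightarrow> a \<noteq> (0::'a::idempotent_semiring)"
  by (metis less_le zero_least)

lemma idem_sum_least:
  fixes f :: "'i \<Rightarrow> 'a::idempotent_semiring"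
  shows "(\<And>i. i \<in> A \<Longrightarrow> f i \<le> c) \<Longrightarrow> sum f A \<le> c"
  by (induction A rule: infinite_finite_induct) (auto simp: zero_least intro: add_least)

lemma idem_sum_upper:
  fixes f :: "'i \<Rightarrow> 'a::idempotent_semiring"
  shows "finite A \<Longrightarrow> i \<in> A \<Longrightarrow> f i \<le> sum f A"
  by (simp add: sum.remove add_upper1)

text \<open>The class only asserts that inverses exist, hence the choice. \<open>sinv 0\<close> is
  unspecified, and the rules below assume a nonzero argument.\<close>

definition sinv :: "'a::idempotent_semifield \<Rightarrow> 'a"
  where "sinv a = (SOME b. a * b = 1 \<and> b * a = 1)"

lemma
  fixes a :: "'a::idempotent_semifield"
  assumes "a \<noteq> 0"
  shows mult_sinv: "a * sinv a = 1" and sinv_mult: "sinv a * a = 1"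
  using someI_ex[OF ex_inverse[OF assms]] by (auto simp: sinv_def)

lemma sinv_nonzero: "a \<noteq> 0 \<Longrightarrow> sinv a \<noteq> (0::'a::idempotent_semifield)"
  by (metis mult_sinv mult_zero_right zero_neq_one)

lemma idem_mult_le_cancel_left:
  fixes a b c :: "'a::idempotent_semifield"
  assumes "c \<noteq> 0"
  shows "c * a \<le> c * b \<longleftrightarrow> a \<le> b"
proof
  assume "c * a \<le> c * b"
  from idem_mult_left_mono[OF this, of "sinv c"] show "a \<le> b"
    by (simp add: mult.assoc[symmetric] sinv_mult assms)
qed (rule idem_mult_left_mono)

lemma idem_mult_le_cancel_right:
  fixes a b c :: "'a::idempotent_semifield"
  assumes "c \<noteq> 0"
  shows "a * c \<le> b * c \<longleftrightarrow> a \<le> b"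
proof
  assume "a * c \<le> b * c"
  from idem_mult_right_mono[OF this, of "sinv c"] show "a \<le> b"
    by (simp add: mult.assoc mult_sinv assms)
qed (rule idem_mult_right_mono)

lemma idem_mult_less_cancel_left:
  fixes a b c :: "'a::idempotent_semifield"
  shows "c \<noteq> 0 \<Longrightarrow> c * a < c * b \<longleftrightarrow> a < b"
  by (simp add: less_le_not_le idem_mult_le_cancel_left)

lemma idem_mult_less_self:
  fixes a c :: "'a::idempotent_semifield"
  shows "a \<noteq> 0 \<Longrightarrow> c < 1 \<Longrightarrow> a * c < a"
  using idem_mult_less_cancel_left[of a c 1] by simp

lemma idem_mult_less_cancel_right:
  fixes a b c :: "'a::idempotent_semifield"
  shows "c \<noteq> 0 \<Longrightarrow> a * c < b * c \<longleftrightarrow> a < b"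
  by (simp add: less_le_not_le idem_mult_le_cancel_right)

lemma sinv_mult_le_iff:
  fixes a b c :: "'a::idempotent_semifield"
  shows "c \<noteq> 0 \<Longrightarrow> sinv c * a \<le> b \<longleftrightarrow> a \<le> c * b"
  using idem_mult_le_cancel_left[of c "sinv c * a" b]
  by (simp add: mult.assoc[symmetric] mult_sinv)

lemma sinv_mult_less_iff:
  fixes a b c :: "'a::idempotent_semifield"
  shows "c \<noteq> 0 \<Longrightarrow> sinv c * a < b \<longleftrightarrow> a < c * b"
  using idem_mult_less_cancel_left[of c "sinv c * a" b]
  by (simp add: mult.assoc[symmetric] mult_sinv)

lemma less_sinv_mult_iff:
  fixes a b c :: "'a::idempotent_semifield"
  shows "c \<noteq> 0 \<Longrightarrow> b < sinv c * a \<longleftrightarrow> c * b < a"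
  using idem_mult_less_cancel_left[of c b "sinv c * a"]
  by (simp add: mult.assoc[symmetric] mult_sinv)

section \<open>Residuation, and totality of the order\<close>

lemma ominus_le_iff:
  fixes \<nu> l m :: "'a::idempotent_semiring"
  assumes "\<exists>m. \<nu> \<le> l + m \<and> (\<forall>m'. \<nu> \<le> l + m' \<longrightarrow> m \<le> m')"
  shows "\<nu> \<ominus> l \<le> m \<longleftrightarrow> \<nu> \<le> l + m"
proof -
  obtain k where k: "\<nu> \<le> l + k" "\<And>m'. \<nu> \<le> l + m' \<Longrightarrow> k \<le> m'"
    using assms by blast
  have "\<nu> \<ominus> l = k" unfolding ominus_def using k by (rule Least_equality)
  \<comment> \<open>The candidates form an up-set, so lying above the least one means being
    one.\<close>
  moreover have "l + k \<le> l + m" if "k \<le> m"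
    using that by (metis add_least add_upper1 add.commute order.trans)
  ultimately show ?thesis using k by (auto intro: order.trans)
qed

text \<open>Left multiplication by \<open>sinv a\<close> reduces the claim to comparing one nonzero
  element \<open>c\<close> with 1. There, minimality of \<open>m\<close> is tested against the
  competitor \<open>m * sinv b\<close>.\<close>

lemma total_if_ominus_exists:
  fixes a b :: "'a::idempotent_semifield"
  assumes ex: "\<And>\<nu> l :: 'a. \<exists>m. \<nu> \<le> l + m \<and> (\<forall>m'. \<nu> \<le> l + m' \<longrightarrow> m \<le> m')"
  shows "a \<le> b \<or> b \<le> a"
proof -
  have unit: "c \<le> 1 \<or> 1 \<le> c" if "c \<noteq> 0" for c :: 'a
  proof -
    define d b where "d = sinv c" and "b = 1 + d"
    have b0: "b \<noteq> 0" by (simp add: b_def add_eq_zero)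
    obtain m where m: "c \<le> 1 + m" "\<And>m'. c \<le> 1 + m' \<Longrightarrow> m \<le> m'" using ex by blast
    have "c * b \<le> b + m"
    proof -
      have "c * b = c + 1" using that by (simp add: b_def d_def distrib_left mult_sinv)
      moreover have "1 + m \<le> b + m"
        by (metis b_def add.assoc add.commute add_upper1)
      moreover have "c + 1 \<le> 1 + m" using m(1) by (simp add: add_least add_upper1)
      ultimately show ?thesis by (simp add: order.trans)
    qed
    also have "b + m = (1 + m * sinv b) * b"
      by (simp add: distrib_right mult.assoc sinv_mult b0)
    finally have "c \<le> 1 + m * sinv b" by (simp add: idem_mult_le_cancel_right b0)
    from m(2)[OF this] have "m * b \<le> m * sinv b * b" by (rule idem_mult_right_mono)
    hence mb: "m * b \<le> m * 1" by (simp add: mult.assoc sinv_mult b0)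
    show ?thesis
    proof (cases "m = 0")
      case True thus ?thesis using m(1) by simp
    next
      case False
      \<comment> \<open>Cancelling \<open>m\<close> leaves \<open>1 + d \<le> 1\<close>, so the
        inverse \<open>d\<close> of \<open>c\<close> is at most 1 and \<open>c\<close> is at least
        1.\<close>
      hence "b \<le> 1" using mb idem_mult_le_cancel_left by blast
      hence "d \<le> 1" by (metis b_def add.commute add_upper1 order.trans)
      hence "c * d \<le> c * 1" by (rule idem_mult_left_mono)
      thus ?thesis using that by (simp add: d_def mult_sinv)
    qed
  qed
  show ?thesis
  proof (cases "a = 0 \<or> b = 0")
    case True thus ?thesis by (auto simp: zero_least)
  next
    case False
    hence "sinv a * b \<le> 1 \<or> 1 \<le> sinv a * b"
      by (intro unit) (simp add: mult_eq_zero sinv_nonzero)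
    moreover have "a * (sinv a * b) = b"
      using False by (simp add: mult.assoc[symmetric] mult_sinv)
    ultimately show ?thesis using False idem_mult_left_mono[of 1 "sinv a * b" a]
      by (auto simp: sinv_mult_le_iff)
  qed
qed


section \<open>Half-spaces in homogeneous coordinates\<close>

text \<open>The entry at \<open>None\<close> turns the constant term of an affine function into a
  coefficient like the others, and convex combinations into linear ones.\<close>

definition homog :: "'k::idempotent_semiring ^ 'n \<Rightarrow> 'n option \<Rightarrow> 'k"
  where "homog x j = (case j of None \<Rightarrow> 1 | Some i \<Rightarrow> x $ i)"

lemma homog_simps [simp]: "homog x None = 1" "homog x (Some i) = x $ i"
  by (simp_all add: homog_def)

lemma homog_inject: "homog x = homog y \<Longrightarrow> x = y"
  by (metis homog_simps(2) vec_eq_iff)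

definition affine_form :: "('n option \<Rightarrow> 'k::idempotent_semiring) \<Rightarrow> 'k ^ 'n::finite \<Rightarrow> 'k"
  where "affine_form W x = (\<Sum>j\<in>UNIV. W j * homog x j)"

lemma affine_form_eq: "affine_form W x = pairing (\<chi> i. W (Some i)) x + W None"
proof -
  have "affine_form W x = W None + (\<Sum>j\<in>range Some. W j * homog x j)"
    unfolding affine_form_def by (simp add: UNIV_option_conv)
  also have "(\<Sum>j\<in>range Some. W j * homog x j) = pairing (\<chi> i. W (Some i)) x"
    by (simp add: sum.reindex pairing_def)
  finally show ?thesis by (simp add: add.commute)
qed

lemma affine_differences_eq:
  "(affine_differences :: ('k::idempotent_semiring ^ 'n::finite \<Rightarrow> 'k) set)
    = {\<lambda>x. affine_form V x \<ominus> affine_form W x | V W. True}" (is "_ = ?R")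
proof (intro equalityI subsetI)
  fix u :: "'k ^ 'n \<Rightarrow> 'k" assume "u \<in> affine_differences"
  then obtain w d w' d' where u: "u = (\<lambda>x. (pairing w x + d) \<ominus> (pairing w' x + d'))"
    unfolding affine_differences_def by blast
  have *: "pairing v x + e = affine_form (case_option e (($) v)) x" for v x and e :: 'k
    by (simp add: affine_form_eq)
  show "u \<in> ?R" unfolding u * by blast
qed (auto simp: affine_differences_def affine_form_eq)

lemma affine_form_term: "W j * homog x j \<le> affine_form W x"
  unfolding affine_form_def by (rule idem_sum_upper) auto

lemma affine_form_le_iff: "affine_form W x \<le> c \<longleftrightarrow> (\<forall>j. W j * homog x j \<le> c)"
proof
  show "\<forall>j. W j * homog x j \<le> c" if "affine_form W x \<le> c"
    using order.trans[OF affine_form_term that] by blast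
qed (simp add: affine_form_def idem_sum_least)

lemma affine_form_single:
  "affine_form (\<lambda>k. if k = j then c else 0) x = c * homog x j"
  by (simp add: affine_form_def if_distrib if_distribR cong: if_cong)

text \<open>Residuation turns a bound on a difference into an inequality between affine forms, so a
  separating difference and a separating half-space can be exchanged.\<close>

lemma U_convex_affine_differences_iff:
  fixes C :: "('k::cc_idempotent_semifield ^ 'n::finite) set"
  assumes ex: "\<And>\<nu> l :: 'k. \<exists>m. \<nu> \<le> l + m \<and> (\<forall>m'. \<nu> \<le> l + m' \<longrightarrow> m \<le> m')"
  shows "U_convex affine_differences C \<longleftrightarrow>
    (\<forall>y. y \<notin> C \<longrightarrow> (\<exists>V W. (\<forall>x\<in>C. affine_form V x \<le> affine_form W x) \<and>
      \<not> affine_form V y \<le> affine_form W y))"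
    (is "_ \<longleftrightarrow> (\<forall>y. y \<notin> C \<longrightarrow> ?sep y)")
proof -
  note iff = ominus_le_iff[OF ex]
  have "(\<exists>u\<in>affine_differences. \<not> Elem (u y) \<le> (SUP x\<in>C. Elem (u x))) \<longleftrightarrow> ?sep y" for y
  proof
    assume "\<exists>u\<in>affine_differences. \<not> Elem (u y) \<le> (SUP x\<in>C. Elem (u x))"
    then obtain V W
      where nle: "\<not> Elem (affine_form V y \<ominus> affine_form W y)
        \<le> (SUP x\<in>C. Elem (affine_form V x \<ominus> affine_form W x))"
      unfolding affine_differences_eq by blast
    \<comment> \<open>\<open>Tau\<close> dominates everything, so the supremum lies in the
      semifield; it is 0 when \<open>C\<close> is empty.\<close>
    then obtain s where s: "(SUP x\<in>C. Elem (affine_form V x \<ominus> affine_form W x)) = Elem s"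
      by (metis completion.exhaust le_completion_simps(1))
    \<comment> \<open>The bound \<open>s\<close> is absorbed into the constant term of the
      right-hand form.\<close>
    define W' where "W' = W(None := W None + s)"
    have W': "affine_form W x + s = affine_form W' x" for x
      by (simp add: affine_form_eq W'_def add.assoc)
    have "affine_form V x \<le> affine_form W' x" if "x \<in> C" for x
    proof -
      have "Elem (affine_form V x \<ominus> affine_form W x) \<le> Elem s"
        unfolding s[symmetric] using that by (rule SUP_upper)
      thus ?thesis by (simp add: iff W')
    qed
    moreover have "\<not> affine_form V y \<le> affine_form W' y"
      using nle by (simp add: s iff W')
    ultimately show "?sep y" by blast
  next
    assume "?sep y"
    then obtain V W where sep: "\<And>x. x \<in> C \<Longrightarrow> affine_form V x \<le> affine_form W x"
      "\<not> affine_form V y \<le> affine_form W y" by blast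
    \<comment> \<open>On the half-space the difference is 0, so 0 is the separating level.\<close>
    have "(SUP x\<in>C. Elem (affine_form V x \<ominus> affine_form W x)) \<le> Elem 0"
      using sep(1) by (auto intro!: SUP_least simp: iff)
    moreover have "\<not> Elem (affine_form V y \<ominus> affine_form W y) \<le> Elem 0"
      using sep(2) by (simp add: iff)
    ultimately have "\<not> Elem (affine_form V y \<ominus> affine_form W y)
        \<le> (SUP x\<in>C. Elem (affine_form V x \<ominus> affine_form W x))"
      using order.trans by blast
    thus "\<exists>u\<in>affine_differences. \<not> Elem (u y) \<le> (SUP x\<in>C. Elem (u x))"
      by (intro bexI[of _ "\<lambda>x. affine_form V x \<ominus> affine_form W x"])
        (auto simp: affine_differences_eq)
  qed
  thus ?thesis by (simp add: U_convex_def)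
qed

text \<open>The condition on the weights is exactly the identity at \<open>None\<close>.\<close>

lemma homog_convex_combination:
  assumes "a + b = 1"
  shows "homog (rscale x a + rscale y b) j = homog x j * a + homog y j * b"
  using assms by (cases j) (simp_all add: rscale_def)

text \<open>With coefficients on the left and scalars on the right, affine forms commute with convex
  combinations, and combinations respect the inequality.\<close>

lemma semimodule_convex_halfspace:
  fixes V W :: "'n::finite option \<Rightarrow> 'k::idempotent_semiring"
  shows "semimodule_convex {x. affine_form V x \<le> affine_form W x}"
proof -
  have comb: "affine_form V (rscale x a + rscale y b) = affine_form V x * a + affine_form V y * b"
    if "a + b = 1" for V :: "'n option \<Rightarrow> 'k" and x y a b
    by (simp add: affine_form_def homog_convex_combination[OF that] distrib_left sum.distrib
        sum_distrib_right mult.assoc)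
  have "p * a + q * b \<le> p' * a + q' * b" if "p \<le> p'" "q \<le> q'" for a b p q p' q' :: 'k
    using that by (metis add_least add_upper1 add.commute idem_mult_right_mono order.trans)
  thus ?thesis by (simp add: semimodule_convex_def comb)
qed

lemma semimodule_convex_Inter:
  "(\<And>X. X \<in> \<X> \<Longrightarrow> semimodule_convex X) \<Longrightarrow> semimodule_convex (\<Inter>\<X>)"
  by (auto simp: semimodule_convex_def)

lemma order_closed_Inter:
  "(\<And>X. X \<in> \<X> \<Longrightarrow> order_closed X) \<Longrightarrow> order_closed (\<Inter>\<X>)"
  unfolding order_closed_def by (intro allI impI InterI) (meson Inter_lower subset_trans)

section \<open>The cone generated by the homogeneous coordinates of a set\<close>

definition cone_over :: "('k::idempotent_semiring ^ 'n) set \<Rightarrow> ('n option \<Rightarrow> 'k) set"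
  where "cone_over C = {\<lambda>j. homog x j * a | x a. x \<in> C}"

text \<open>Dividing by the total weight \<open>a + b\<close> turns the sum into the homogeneous
  coordinates of a convex combination. The total vanishes only if both weights do, and then the sum
  is the zero multiple of \<open>x\<close>.\<close>

lemma cone_over_add:
  fixes C :: "('k::idempotent_semifield ^ 'n) set"
  assumes C: "semimodule_convex C" and "v \<in> cone_over C" "w \<in> cone_over C"
  shows "(\<lambda>j. v j + w j) \<in> cone_over C"
proof -
  obtain x a y b where v: "v = (\<lambda>j. homog x j * a)" and w: "w = (\<lambda>j. homog y j * b)"
    and xy: "x \<in> C" "y \<in> C" using assms(2,3) by (auto simp: cone_over_def)
  show ?thesis
  proof (cases "a + b = 0")
    case True
    hence "(\<lambda>j. v j + w j) = (\<lambda>j. homog x j * 0)" by (simp add: v w add_eq_zero)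
    thus ?thesis using xy(1) unfolding cone_over_def by blast
  next
    case False
    define s where "s = sinv (a + b)"
    have s: "a * s + b * s = 1" using False by (simp add: s_def distrib_right[symmetric] mult_sinv)
    define z where "z = rscale x (a * s) + rscale y (b * s)"
    have "z \<in> C" using C xy s by (simp add: semimodule_convex_def z_def)
    moreover have "v j + w j = homog z j * (a + b)" for j
    proof -
      have "homog z j = (v j + w j) * s"
        by (simp only: z_def homog_convex_combination[OF s] v w distrib_right mult.assoc)
      thus ?thesis using False by (simp add: mult.assoc s_def sinv_mult)
    qed
    ultimately show ?thesis unfolding cone_over_def by blast
  qed
qed

text \<open>The index set has to be nonempty: for empty \<open>C\<close> the cone is empty and does
  not contain the zero function.\<close>

lemma cone_over_sum:
  fixes C :: "('k::idempotent_semifield ^ 'n) set"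
  assumes "semimodule_convex C" "finite I" "I \<noteq> {}" "\<And>i. i \<in> I \<Longrightarrow> v i \<in> cone_over C"
  shows "(\<lambda>j. \<Sum>i\<in>I. v i j) \<in> cone_over C"
  using assms(2-4)
proof (induction I rule: finite_ne_induct)
  case (insert i I)
  thus ?case using cone_over_add[OF assms(1), of "v i"] by simp
qed simp


text \<open>One cone element is taken for each threshold and entry. Addition is supremum, so their
  sum stays below \<open>Y\<close> and passes all finitely many thresholds at once.\<close>

lemma cone_over_approx:
  fixes C :: "('k::idempotent_semifield ^ 'n::finite) set"
  assumes C: "semimodule_convex C" and "finite F"
    and ex: "\<And>j z. z < homog y j \<Longrightarrow> \<exists>v\<in>cone_over C. v \<le> Y \<and> z < v j"
  shows "\<exists>v\<in>cone_over C. v \<le> Y \<and> (\<forall>j. \<forall>e\<in>F. e < homog y j \<longrightarrow> e < v j)"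
proof -
  \<comment> \<open>Inserting 0 keeps the index set nonempty: the entry at \<open>None\<close> is 1,
    which exceeds 0.\<close>
  define I where "I = {(e, j). e \<in> insert 0 F \<and> e < homog y j}"
  have "(0, None) \<in> I" by (simp add: I_def idem_zero_less)
  have "I \<subseteq> insert 0 F \<times> UNIV" by (auto simp: I_def)
  hence fin: "finite I" by (rule finite_subset) (simp add: assms(2))
  have "\<forall>p\<in>I. \<exists>v\<in>cone_over C. v \<le> Y \<and> fst p < v (snd p)"
    using ex by (auto simp: I_def)
  then obtain v where v: "\<And>p. p \<in> I \<Longrightarrow> v p \<in> cone_over C" "\<And>p. p \<in> I \<Longrightarrow> v p \<le> Y"
    "\<And>p. p \<in> I \<Longrightarrow> fst p < v p (snd p)" by metis
  define w where "w j = (\<Sum>p\<in>I. v p j)" for j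
  have "w \<in> cone_over C"
    unfolding w_def using C fin \<open>(0, None) \<in> I\<close> v(1) by (intro cone_over_sum) auto
  moreover have "w \<le> Y"
    using v(2) by (auto simp: le_fun_def w_def intro!: idem_sum_least)
  moreover have "e < w j" if "e \<in> F" "e < homog y j" for e j
  proof -
    have I: "(e, j) \<in> I" using that by (simp add: I_def)
    have "e < v (e, j) j" using v(3)[OF I] by simp
    also have "\<dots> \<le> w j" unfolding w_def using fin I by (rule idem_sum_upper)
    finally show ?thesis .
  qed
  ultimately show ?thesis by blast
qed


section \<open>Order convergence of nets in terms of strict inequalities\<close>

lemma isGlb_UNIV_iff:
  "isGlb UNIV S x \<longleftrightarrow> (\<forall>s\<in>S. x \<le> s) \<and> (\<forall>q. (\<forall>s\<in>S. q \<le> s) \<longrightarrow> q \<le> x)"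
  by (auto simp: isGlb_def greatestP_def isLb_def setge_def setle_def)

lemma isLub_UNIV_iff:
  "isLub UNIV S x \<longleftrightarrow> (\<forall>s\<in>S. s \<le> x) \<and> (\<forall>q. (\<forall>s\<in>S. s \<le> q) \<longrightarrow> x \<le> q)"
  by (auto simp: isLub_def leastP_def isUb_def setge_def setle_def)

text \<open>The section filter of a net; for directed \<open>L\<close> the tails are a base, and
  finitely many eventual statements can be combined.\<close>

definition tails :: "'i set \<Rightarrow> 'i rel \<Rightarrow> 'i filter"
  where "tails L r = (INF l\<in>L. principal (r `` {l}))"

lemma eventually_tails:
  assumes L: "directed_set L r"
  shows "eventually P (tails L r) \<longleftrightarrow> (\<exists>l\<in>L. \<forall>m\<in>r `` {l}. P m)"
proof -
  have tr: "trans r" using L by (simp add: directed_set_def preorder_on_def)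
  have "\<exists>c\<in>L. principal (r `` {c}) \<le> inf (principal (r `` {a})) (principal (r `` {b}))"
    if ab: "a \<in> L" "b \<in> L" for a b
  proof -
    obtain c where c: "c \<in> L" "(a, c) \<in> r" "(b, c) \<in> r"
      using L ab by (auto simp: directed_set_def)
    hence "r `` {c} \<subseteq> r `` {a} \<inter> r `` {b}" using tr by (auto dest: transD)
    thus ?thesis using c(1) by auto
  qed
  thus ?thesis
    unfolding tails_def using L
    by (subst eventually_INF_base) (auto simp: directed_set_def eventually_principal)
qed

section \<open>Nets over a totally ordered semifield\<close>

locale total_semifield =
  fixes carrier_type :: "'k::cc_idempotent_semifield itself"
  assumes total: "(a::'k) \<le> b \<or> b \<le> a"
begin

text \<open>Totality is not part of the type class, so the facts on linear orders come from an
  interpretation.\<close>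

sublocale lin: linorder "(\<le>) :: 'k \<Rightarrow> 'k \<Rightarrow> bool" "(<)"
  by standard (rule total)

text \<open>In a chain a finite nonempty sum is a maximum; the empty sum is 0, whence
  \<open>e \<noteq> 0\<close>.\<close>

lemma sum_less:
  fixes f :: "'i \<Rightarrow> 'k"
  shows "e \<noteq> 0 \<Longrightarrow> (\<And>i. i \<in> A \<Longrightarrow> f i < e) \<Longrightarrow> sum f A < e"
proof (induction A rule: infinite_finite_induct)
  case (insert i A)
  have "f i + sum f A = f i \<or> f i + sum f A = sum f A"
    using total[of "f i" "sum f A"] by (metis add.commute natural_order)
  thus ?case using insert by auto
qed (auto simp: idem_zero_less)

text \<open>Otherwise entry \<open>i\<close> reaches \<open>e\<close> in every tail, and
  \<open>x\<close> with this entry raised to \<open>e\<close> is still a lower bound of all tail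
  suprema, whose infimum is \<open>x\<close>.\<close>

lemma eventually_less_if_order_converges:
  fixes f :: "'i \<Rightarrow> 'k ^ 'n::finite"
  assumes L: "directed_set L r" and conv: "order_converges L r f x" and e: "x $ i < e"
  shows "eventually (\<lambda>m. f m $ i < e) (tails L r)"
proof (rule ccontr)
  assume "\<not> ?thesis"
  hence ge: "\<exists>m\<in>r `` {l}. e \<le> f m $ i" if "l \<in> L" for l
    using that by (auto simp: eventually_tails[OF L] lin.not_less)
  define S where "S = {s. \<exists>l\<in>L. isLub UNIV (f ` (r `` {l})) s}"
  define q where "q = (\<chi> k. if k = i then e else x $ k)"
  have glb: "isGlb UNIV S x" using conv by (simp add: order_converges_def S_def)
  have "q \<le> s" if s: "s \<in> S" for s
  proof -
    obtain l where l: "l \<in> L" "isLub UNIV (f ` (r `` {l})) s" using s by (auto simp: S_def)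
    obtain m where m: "m \<in> r `` {l}" "e \<le> f m $ i" using ge[OF l(1)] by blast
    have "f m \<le> s" using l(2) m(1) by (auto simp: isLub_UNIV_iff)
    hence "e \<le> s $ i" using m(2) by (auto simp: less_eq_vec_def intro: order.trans)
    moreover have "x \<le> s" using glb s by (simp add: isGlb_UNIV_iff)
    ultimately show ?thesis by (simp add: less_eq_vec_def q_def)
  qed
  hence "q \<le> x" using glb by (simp add: isGlb_UNIV_iff)
  hence "q $ i \<le> x $ i" by (simp only: less_eq_vec_def)
  thus False using e by (simp add: q_def)
qed

text \<open>Dually, \<open>x\<close> with entry \<open>i\<close> lowered to \<open>e\<close> would
  be an upper bound of all tail infima.\<close>

lemma eventually_greater_if_order_converges:
  fixes f :: "'i \<Rightarrow> 'k ^ 'n::finite"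
  assumes L: "directed_set L r" and conv: "order_converges L r f x" and e: "e < x $ i"
  shows "eventually (\<lambda>m. e < f m $ i) (tails L r)"
proof (rule ccontr)
  assume "\<not> ?thesis"
  hence ge: "\<exists>m\<in>r `` {l}. f m $ i \<le> e" if "l \<in> L" for l
    using that by (auto simp: eventually_tails[OF L] lin.not_less)
  define S where "S = {t. \<exists>l\<in>L. isGlb UNIV (f ` (r `` {l})) t}"
  define q where "q = (\<chi> k. if k = i then e else x $ k)"
  have lub: "isLub UNIV S x" using conv by (simp add: order_converges_def S_def)
  have "t \<le> q" if t: "t \<in> S" for t
  proof -
    obtain l where l: "l \<in> L" "isGlb UNIV (f ` (r `` {l})) t" using t by (auto simp: S_def)
    obtain m where m: "m \<in> r `` {l}" "f m $ i \<le> e" using ge[OF l(1)] by blast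
    have "t \<le> f m" using l(2) m(1) by (auto simp: isGlb_UNIV_iff)
    hence "t $ i \<le> e" using m(2) by (auto simp: less_eq_vec_def intro: order.trans)
    moreover have "t \<le> x" using lub t by (simp add: isLub_UNIV_iff)
    ultimately show ?thesis by (simp add: less_eq_vec_def q_def)
  qed
  hence "x \<le> q" using lub by (simp add: isLub_UNIV_iff)
  hence "x $ i \<le> q $ i" by (simp only: less_eq_vec_def)
  thus False using e by (simp add: q_def)
qed

text \<open>Affine forms inherit the eventual strict inequalities from the entries. If the limit
  violated the half-space, the net would eventually violate it too.\<close>

lemma order_closed_halfspace:
  fixes V W :: "'n::finite option \<Rightarrow> 'k"
  shows "order_closed {x. affine_form V x \<le> affine_form W x}"
  unfolding order_closed_def
proof (intro allI impI)
  fix L r f and x :: "'k ^ 'n"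
  assume L: "directed_set (L :: (('k ^ 'n) \<times> ('k ^ 'n) set) set) r"
    and fL: "f ` L \<subseteq> {x. affine_form V x \<le> affine_form W x}" and conv: "order_converges L r f x"
  note ev = eventually_less_if_order_converges[OF L conv]
    eventually_greater_if_order_converges[OF L conv]
  have half: "eventually (\<lambda>m. affine_form V (f m) \<le> affine_form W (f m)) (tails L r)"
  proof -
    obtain l where "l \<in> L" using L by (auto simp: directed_set_def)
    moreover have "r \<subseteq> L \<times> L" using L by (auto simp: directed_set_def preorder_on_def refl_on_def)
    ultimately show ?thesis using fL by (auto simp: eventually_tails[OF L])
  qed
  \<comment> \<open>By reflexivity each tail contains its own index, so the filter is
    proper.\<close>
  have nontriv: "tails L r \<noteq> bot"
    using L by (force simp: trivial_limit_def eventually_tails[OF L] directed_set_def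
        preorder_on_def refl_on_def)
  have lower: "eventually (\<lambda>m. e < affine_form V (f m)) (tails L r)" if "e < affine_form V x" for e
  proof -
    have "\<exists>j. e < V j * homog x j"
      using that by (simp add: lin.not_le[symmetric] affine_form_le_iff)
    then obtain j where j: "e < V j * homog x j" ..
    have "eventually (\<lambda>m. e < V j * homog (f m) j) (tails L r)"
    proof (cases j)
      \<comment> \<open>Dividing by the nonzero coefficient reduces the claim to entry
        \<open>i\<close>; at \<open>None\<close> the term is constant along the net.\<close>
      case (Some i)
      have V: "V j \<noteq> 0" using j by (auto simp: less_le_not_le zero_least)
      have "sinv (V j) * e < x $ i" using j V Some by (simp add: sinv_mult_less_iff)
      from ev(2)[OF this] show ?thesis using V Some by (simp add: sinv_mult_less_iff)
    qed (use j in simp)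
    thus ?thesis by eventually_elim (meson affine_form_term order.strict_trans2)
  qed
  have upper: "eventually (\<lambda>m. affine_form W (f m) < e) (tails L r)" if "affine_form W x < e" for e
  proof -
    have e: "e \<noteq> 0" using that by (auto simp: less_le_not_le zero_least)
    have "eventually (\<lambda>m. W j * homog (f m) j < e) (tails L r)" for j
    proof (cases "W j = 0")
      case True
      thus ?thesis using e by (simp add: idem_zero_less)
    next
      case False
      have j: "W j * homog x j < e" using that affine_form_term order.strict_trans1 by blast
      show ?thesis
      proof (cases j)
        case (Some i)
        have "x $ i < sinv (W j) * e" using j False Some by (simp add: less_sinv_mult_iff)
        from ev(1)[OF this] show ?thesis using False Some by (simp add: less_sinv_mult_iff)
      qed (use j in simp)
    qed
    hence "eventually (\<lambda>m. \<forall>j. W j * homog (f m) j < e) (tails L r)"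
      by (simp add: eventually_all_finite)
    thus ?thesis by eventually_elim (simp add: affine_form_def sum_less e)
  qed
  have "affine_form V x \<le> affine_form W x"
  proof (rule ccontr)
    assume "\<not> ?thesis"
    hence lt: "affine_form W x < affine_form V x" by (simp add: lin.not_le)
    show False
    proof (cases "\<exists>e. affine_form W x < e \<and> e < affine_form V x")
      case True
      then obtain e where "affine_form W x < e" "e < affine_form V x" by blast
      from upper[OF this(1)] lower[OF this(2)] half
      have "eventually (\<lambda>m. False) (tails L r)"
        by eventually_elim order
      thus False using nontriv by (simp add: trivial_limit_def)
    next
      case False
      \<comment> \<open>Nothing lies between the two values, so exceeding the smaller one means
        reaching the larger one.\<close>
      have "eventually (\<lambda>m. False) (tails L r)"
        using lower[OF lt] upper[OF lt] half
      proof eventually_elim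
        case (elim m)
        have "affine_form V x \<le> affine_form V (f m)" using elim(1) False lin.not_le by blast
        thus False using elim(2,3) by simp
      qed
      thus False using nontriv by (simp add: trivial_limit_def)
    qed
  qed
  thus "x \<in> {x. affine_form V x \<le> affine_form W x}" by simp
qed

section \<open>Boxes cut out by finitely many thresholds\<close>

definition near :: "'k set \<Rightarrow> 'k ^ 'n \<Rightarrow> 'k ^ 'n \<Rightarrow> bool"
  where "near F y x \<longleftrightarrow> (\<forall>i. \<forall>e\<in>F. (e < y $ i \<longrightarrow> e < x $ i) \<and> (y $ i < e \<longrightarrow> x $ i < e))"

lemma near_antimono: "F \<subseteq> G \<Longrightarrow> near G y x \<Longrightarrow> near F y x"
  by (auto simp: near_def)

text \<open>The net is indexed by finite threshold sets under inclusion and picks a point of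
  \<open>C\<close> near \<open>y\<close> for each of them; it order converges to
  \<open>y\<close>.\<close>

lemma mem_order_closed_if_near:
  fixes C :: "('k ^ 'n::finite) set"
  assumes C: "order_closed C" and ex: "\<And>F. finite F \<Longrightarrow> \<exists>x\<in>C. near F y x"
  shows "y \<in> C"
proof -
  \<comment> \<open>An order convergent net has to be bounded above: either a threshold above the
    entry \<open>y $ i\<close> bounds nearby points, or this entry is the greatest element.\<close>
  have "\<exists>F M. finite F \<and> (\<forall>x. near F y x \<longrightarrow> x $ i \<le> M)" for i
  proof (cases "\<exists>e. y $ i < e")
    case True
    then obtain e where "y $ i < e" by blast
    thus ?thesis by (intro exI[of _ "{e}"] exI[of _ e]) (auto simp: near_def less_imp_le)
  next
    case False
    thus ?thesis by (intro exI[of _ "{}"] exI[of _ "y $ i"]) (auto simp: lin.not_less)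
  qed
  then obtain F M where FM: "\<And>i. finite (F i)" "\<And>i x. near (F i) y x \<Longrightarrow> x $ i \<le> M i"
    by metis
  define F0 where "F0 = (\<Union>i. F i)"
  have F0: "finite F0" using FM(1) by (simp add: F0_def)
  have bound: "x \<le> (\<chi> i. M i)" if "near F0 y x" for x
  proof -
    have "near (F i) y x" for i using that by (rule near_antimono[rotated]) (auto simp: F0_def)
    thus ?thesis using FM(2) by (simp add: less_eq_vec_def)
  qed
  \<comment> \<open>Starting at \<open>F0\<close> makes the whole net bounded.\<close>
  define L where "L = {G. finite G \<and> F0 \<subseteq> G}"
  define r where "r = {(G, H). G \<in> L \<and> H \<in> L \<and> G \<subseteq> H}"
  define f where "f G = (SOME x. x \<in> C \<and> near G y x)" for G
  have f: "f G \<in> C" "near G y (f G)" if "G \<in> L" for G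
  proof -
    have "\<exists>x. x \<in> C \<and> near G y x" using ex that by (auto simp: L_def)
    from someI_ex[OF this] show "f G \<in> C" "near G y (f G)" by (auto simp: f_def)
  qed
  have ins: "insert e G \<in> L" "(G, insert e G) \<in> r" if "G \<in> L" for e G
    using that by (auto simp: L_def r_def)
  have F0L: "F0 \<in> L" using F0 by (simp add: L_def)
  have L: "directed_set L r"
    unfolding directed_set_def
  proof (intro conjI ballI)
    show "L \<noteq> {}" using F0L by blast
    show "preorder_on L r" by (auto simp: preorder_on_def refl_on_def trans_def r_def)
    fix G H assume "G \<in> L" "H \<in> L"
    thus "\<exists>K\<in>L. (G, K) \<in> r \<and> (H, K) \<in> r"
      by (intro bexI[of _ "G \<union> H"]) (auto simp: L_def r_def)
  qed
  have bddA: "bdd_above (f ` L)"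
  proof (rule bdd_aboveI2)
    fix G assume G: "G \<in> L"
    hence "near F0 y (f G)" by (intro near_antimono[OF _ f(2)]) (auto simp: L_def)
    thus "f G \<le> (\<chi> i. M i)" by (rule bound)
  qed
  have bddB: "bdd_below (f ` L)"
    by (intro bdd_belowI[of _ 0]) (auto simp: less_eq_vec_def zero_least)
  have tail: "f ` (r `` {G}) \<noteq> {}" "f ` (r `` {G}) \<subseteq> f ` L" if "G \<in> L" for G
    using that by (auto simp: r_def)
  have nearT: "near G y (f H)" if "H \<in> r `` {G}" for G H
    using that f(2)[of H] near_antimono[of G H] by (auto simp: r_def)
  have "isGlb UNIV {s. \<exists>G\<in>L. isLub UNIV (f ` (r `` {G})) s} y" (is "isGlb UNIV ?S y")
    unfolding isGlb_UNIV_iff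
  proof (intro conjI ballI allI impI)
    fix s assume "s \<in> ?S"
    then obtain G where G: "G \<in> L" "isLub UNIV (f ` (r `` {G})) s" by blast
    show "y \<le> s" unfolding less_eq_vec_def
    proof (rule allI, rule ccontr)
      fix i assume "\<not> y $ i \<le> s $ i"
      hence "s $ i < f (insert (s $ i) G) $ i"
        using f(2)[OF ins(1)[OF G(1)]] by (auto simp: near_def lin.not_le)
      moreover have "f (insert (s $ i) G) \<le> s"
        using G(2) ins(2)[OF G(1)] by (auto simp: isLub_UNIV_iff)
      ultimately show False by (auto simp: less_eq_vec_def lin.not_le[symmetric])
    qed
  next
    fix q assume q: "\<forall>s\<in>?S. q \<le> s"
    \<comment> \<open>A bound on one entry along a tail passes to the supremum of this tail, and
      hence to \<open>q\<close>.\<close>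
    have key: "q $ i \<le> c" if G: "G \<in> L" and c: "\<And>H. H \<in> r `` {G} \<Longrightarrow> f H $ i \<le> c" for i c G
    proof -
      let ?s = "\<chi> k. SUP x\<in>f ` (r `` {G}). x $ k"
      have "isLub UNIV (f ` (r `` {G})) ?s"
        using tail[OF G] bddA by (intro isLub_vec) (auto intro: bdd_above_mono)
      hence "q \<le> ?s" using q G by blast
      moreover have "?s $ i \<le> c" using tail(1)[OF G] c by (auto intro!: cSUP_least)
      ultimately show ?thesis by (auto simp: less_eq_vec_def intro: order.trans)
    qed
    show "q \<le> y" unfolding less_eq_vec_def
    proof (rule allI, rule ccontr)
      fix i assume "\<not> q $ i \<le> y $ i"
      hence lt: "y $ i < q $ i" by (simp add: lin.not_le)
      show False
      proof (cases "\<exists>e. y $ i < e \<and> e < q $ i")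
        case True
        then obtain e where e: "y $ i < e" "e < q $ i" by blast
        have "q $ i \<le> e"
          by (rule key[OF ins(1)[OF F0L, of e]])
            (use e nearT in \<open>fastforce simp: near_def intro: less_imp_le\<close>)
        thus False using e by simp
      next
        case False
        \<comment> \<open>With no element in between, the threshold \<open>q $ i\<close> itself
          forces entry \<open>i\<close> down to \<open>y $ i\<close>.\<close>
        have "f H $ i \<le> y $ i" if "H \<in> r `` {insert (q $ i) F0}" for H
          using nearT[OF that] lt False by (force simp: near_def lin.not_less[symmetric])
        from key[OF ins(1)[OF F0L, of "q $ i"] this] show False using lt by simp
      qed
    qed
  qed
  moreover have "isLub UNIV {t. \<exists>G\<in>L. isGlb UNIV (f ` (r `` {G})) t} y" (is "isLub UNIV ?S y")
    unfolding isLub_UNIV_iff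
  proof (intro conjI ballI allI impI)
    fix t assume "t \<in> ?S"
    then obtain G where G: "G \<in> L" "isGlb UNIV (f ` (r `` {G})) t" by blast
    show "t \<le> y" unfolding less_eq_vec_def
    proof (rule allI, rule ccontr)
      fix i assume "\<not> t $ i \<le> y $ i"
      hence "f (insert (t $ i) G) $ i < t $ i"
        using f(2)[OF ins(1)[OF G(1)]] by (auto simp: near_def lin.not_le)
      moreover have "t \<le> f (insert (t $ i) G)"
        using G(2) ins(2)[OF G(1)] by (auto simp: isGlb_UNIV_iff)
      ultimately show False by (auto simp: less_eq_vec_def lin.not_le[symmetric])
    qed
  next
    fix q assume q: "\<forall>t\<in>?S. t \<le> q"
    have key: "c \<le> q $ i" if G: "G \<in> L" and c: "\<And>H. H \<in> r `` {G} \<Longrightarrow> c \<le> f H $ i" for i c G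
    proof -
      let ?t = "\<chi> k. INF x\<in>f ` (r `` {G}). x $ k"
      have "isGlb UNIV (f ` (r `` {G})) ?t"
        using tail[OF G] bddB by (intro isGlb_vec) (auto intro: bdd_below_mono)
      hence "?t \<le> q" using q G by blast
      moreover have "c \<le> ?t $ i" using tail(1)[OF G] c by (auto intro!: cINF_greatest)
      ultimately show ?thesis by (auto simp: less_eq_vec_def intro: order.trans)
    qed
    show "y \<le> q" unfolding less_eq_vec_def
    proof (rule allI, rule ccontr)
      fix i assume "\<not> y $ i \<le> q $ i"
      hence lt: "q $ i < y $ i" by (simp add: lin.not_le)
      show False
      proof (cases "\<exists>e. q $ i < e \<and> e < y $ i")
        case True
        then obtain e where e: "q $ i < e" "e < y $ i" by blast
        have "e \<le> q $ i"
          by (rule key[OF ins(1)[OF F0L, of e]])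
            (use e nearT in \<open>fastforce simp: near_def intro: less_imp_le\<close>)
        thus False using e by simp
      next
        case False
        have "y $ i \<le> f H $ i" if "H \<in> r `` {insert (q $ i) F0}" for H
          using nearT[OF that] lt False by (force simp: near_def lin.not_less[symmetric])
        from key[OF ins(1)[OF F0L, of "q $ i"] this] show False using lt by simp
      qed
    qed
  qed
  ultimately have "order_converges L r f y"
    using bddA bddB by (simp add: order_converges_def)
  thus ?thesis using f(1) by (intro order_closedD[OF C L]) auto
qed


section \<open>Separation\<close>

text \<open>Multiplication by \<open>c\<close> moves a nonzero element strictly down without
  reaching 0. In the semifield \<open>{0, 1}\<close> there is no such \<open>c\<close>, and the
  conclusion fails for \<open>F = {1}\<close>.\<close>

lemma ex_nonzero_below_finite:
  fixes c :: 'k and F :: "'k set"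
  assumes c: "c \<noteq> 0" "c < 1" and "finite F"
  shows "\<exists>d. d \<noteq> 0 \<and> (\<forall>e\<in>F. e \<noteq> 0 \<longrightarrow> d < e)"
  using assms(3)
proof (induction F)
  case empty
  show ?case using c(1) by (intro exI[of _ c]) simp
next
  case (insert a F)
  then obtain d where d: "d \<noteq> 0" "\<And>e. e \<in> F \<Longrightarrow> e \<noteq> 0 \<Longrightarrow> d < e" by blast
  show ?case
  proof (cases "a = 0 \<or> d < a")
    case True
    thus ?thesis using d by (intro exI[of _ d]) auto
  next
    case False
    hence ad: "a \<noteq> 0" "a \<le> d" by (auto simp: lin.not_less)
    have "a * c < a" using ad(1) c(2) by (rule idem_mult_less_self)
    thus ?thesis using ad c(1) d(2)
      by (intro exI[of _ "a * c"]) (auto simp: mult_eq_zero intro: order.strict_trans2 order.strict_trans)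
  qed
qed

text \<open>The half-space defined by \<open>V\<close> and \<open>W\<close> excludes
  \<open>y\<close>, so some point of \<open>C\<close> violates it; dividing by its value
  \<open>b\<close> under \<open>W\<close> gives \<open>v\<close>.\<close>

lemma ex_cone_point:
  fixes C :: "('k ^ 'n::finite) set" and Y :: "'n option \<Rightarrow> 'k"
  assumes nonsep: "\<And>V W. (\<And>x. x \<in> C \<Longrightarrow> affine_form V x \<le> affine_form W x) \<Longrightarrow>
      affine_form V y \<le> affine_form W y"
    and Y: "homog y \<le> Y" "\<And>j. Y j \<noteq> 0" and z: "z \<noteq> 0" "z < homog y j"
  shows "\<exists>v\<in>cone_over C. v \<le> Y \<and> z < v j"
proof -
  \<comment> \<open>For a cone element \<open>v\<close>, the form \<open>W\<close> is at most 1 iff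
    \<open>v \<le> Y\<close>, and \<open>V\<close> exceeds 1 iff \<open>z < v j\<close>.\<close>
  define V W where "V = (\<lambda>k. if k = j then sinv z else 0)" and "W = (\<lambda>k. sinv (Y k))"
  have V: "affine_form V x = sinv z * homog x j" for x :: "'k ^ 'n"
    unfolding V_def by (rule affine_form_single)
  have "affine_form W y \<le> 1"
    using Y by (auto simp: affine_form_le_iff W_def sinv_mult_le_iff le_fun_def)
  moreover have "1 < affine_form V y" using z by (simp add: V less_sinv_mult_iff)
  ultimately have "\<not> affine_form V y \<le> affine_form W y" using lin.not_le by force
  then obtain x where x: "x \<in> C" "affine_form W x < affine_form V x"
    using nonsep lin.not_le by metis
  define b where "b = affine_form W x"
  \<comment> \<open>The term at \<open>None\<close> does not depend on \<open>x\<close> and keeps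
    the divisor \<open>b\<close> nonzero.\<close>
  have "W None * 1 \<le> b" using affine_form_term[of W None x] by (simp add: b_def)
  hence b: "b \<noteq> 0" using Y(2) sinv_nonzero[of "Y None"] by (auto simp: W_def idem_le_zero)
  define v where "v k = homog x k * sinv b" for k
  have "v \<in> cone_over C" using x(1) unfolding cone_over_def v_def[abs_def] by blast
  moreover have "v k \<le> Y k" for k
  proof -
    have "homog x k \<le> Y k * b"
      using affine_form_term[of W k x] Y(2) by (simp add: W_def b_def sinv_mult_le_iff)
    hence "v k \<le> Y k * b * sinv b" unfolding v_def by (rule idem_mult_right_mono)
    thus ?thesis using b by (simp add: mult.assoc mult_sinv)
  qed
  moreover have "z < v j"
  proof -
    have "z * b < homog x j" using x(2) z(1) by (simp add: V b_def less_sinv_mult_iff)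
    hence "z * b * sinv b < v j"
      unfolding v_def using b by (simp only: idem_mult_less_cancel_right sinv_nonzero not_False_eq_True)
    thus ?thesis using b by (simp add: mult.assoc mult_sinv)
  qed
  ultimately show ?thesis by (auto simp: le_fun_def)
qed

text \<open>A cone element close to \<open>homog y\<close> has the form \<open>homog x j * a\<close>
  with \<open>c < a \<le> 1\<close>. The thresholds are chosen so that \<open>x\<close> is still
  near \<open>y\<close> after division by \<open>a\<close>.\<close>

lemma mem_if_not_separated_nontrivial:
  fixes C :: "('k ^ 'n::finite) set" and c :: 'k
  assumes c: "c \<noteq> 0" "c < 1" and C: "semimodule_convex C" "order_closed C"
    and nonsep: "\<And>V W. (\<And>x. x \<in> C \<Longrightarrow> affine_form V x \<le> affine_form W x) \<Longrightarrow>
      affine_form V y \<le> affine_form W y"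
  shows "y \<in> C"
proof (rule mem_order_closed_if_near[OF C(2)])
  fix F :: "'k set" assume F: "finite F"
  \<comment> \<open>\<open>d\<close> replaces the zero entries of \<open>homog y\<close>; the factor
    \<open>c\<close> leaves room for the division by \<open>a\<close>.\<close>
  obtain d where d: "d \<noteq> 0" "\<And>e. e \<in> F \<Longrightarrow> e \<noteq> 0 \<Longrightarrow> d < e * c"
    using ex_nonzero_below_finite[OF c, of "(\<lambda>e. e * c) ` F"] F c(1)
    by (auto simp: mult_eq_zero)
  define Y where "Y j = (if homog y j = 0 then d else homog y j)" for j
  \<comment> \<open>At \<open>None\<close>, \<open>c\<close> bounds \<open>a\<close> from below, and
    \<open>sinv e * y $ i < a\<close> gives \<open>y $ i < e * a\<close>, the upper estimate for
    \<open>x $ i * a\<close>. The arbitrary value \<open>sinv 0\<close> may only add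
    thresholds.\<close>
  define F' where "F' = insert c (F \<union> (\<lambda>(e, i). sinv e * y $ i) ` (F \<times> UNIV))"
  have Y: "homog y \<le> Y" "Y j \<noteq> 0" for j
    using d(1) by (auto simp: Y_def le_fun_def zero_least)
  have "\<exists>v\<in>cone_over C. v \<le> Y \<and> z < v j" if z: "z < homog y j" for j z
  proof (cases "z = 0")
    \<comment> \<open>\<open>ex_cone_point\<close> needs a nonzero threshold, so 0 is replaced by a
      nonzero element strictly below the entry.\<close>
    case True
    hence y: "homog y j \<noteq> 0" using z by (auto simp: idem_zero_less)
    hence "homog y j * c < homog y j" using c(2) by (rule idem_mult_less_self)
    hence "\<exists>v\<in>cone_over C. v \<le> Y \<and> homog y j * c < v j"
      using y c(1) by (intro ex_cone_point[OF nonsep Y]) (auto simp: mult_eq_zero)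
    thus ?thesis using True by (meson zero_least order.strict_trans1)
  qed (rule ex_cone_point[OF nonsep Y _ z])
  moreover have "finite F'" using F by (simp add: F'_def)
  ultimately obtain v where v: "v \<in> cone_over C" "v \<le> Y"
      "\<And>j e. e \<in> F' \<Longrightarrow> e < homog y j \<Longrightarrow> e < v j"
    using cone_over_approx[OF C(1)] by metis
  then obtain x a where x: "x \<in> C" "v = (\<lambda>j. homog x j * a)" by (auto simp: cone_over_def)
  have "v None \<le> Y None" using v(2) by (simp add: le_fun_def)
  hence a1: "a \<le> 1" by (simp add: x(2) Y_def)
  have ca: "c < a" using v(3)[of c None] c(2) by (simp add: F'_def x(2))
  hence a0: "a \<noteq> 0" by (auto simp: less_le_not_le zero_least)
  have "near F y x"
    unfolding near_def
  proof (intro allI ballI conjI impI)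
    fix i e assume e: "e \<in> F" "e < y $ i"
    hence "e < x $ i * a" using v(3)[of e "Some i"] by (simp add: F'_def x(2))
    also have "\<dots> \<le> x $ i" using idem_mult_left_mono[OF a1, of "x $ i"] by simp
    finally show "e < x $ i" .
  next
    fix i e assume e: "e \<in> F" "y $ i < e"
    have e0: "e \<noteq> 0" using e(2) by (auto simp: less_le_not_le zero_least)
    have xY: "x $ i * a \<le> Y (Some i)" using v(2) by (metis x(2) homog_simps(2) le_fun_def)
    also have "Y (Some i) < e * a"
    proof (cases "y $ i = 0")
      case True
      have "d < e * c" using d(2) e(1) e0 by blast
      also have "\<dots> < e * a" using ca e0 by (simp add: idem_mult_less_cancel_left)
      finally show ?thesis using True by (simp add: Y_def)
    next
      case False
      have "sinv e * y $ i \<in> F'" using e(1) by (auto simp: F'_def)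
      moreover have "sinv e * y $ i < homog y None" using e(2) e0 by (simp add: sinv_mult_less_iff)
      ultimately have "sinv e * y $ i < a" using v(3) x(2) by fastforce
      thus ?thesis using e0 False by (simp add: Y_def sinv_mult_less_iff)
    qed
    finally show "x $ i < e" using a0 by (simp add: idem_mult_less_cancel_right)
  qed
  thus "\<exists>x\<in>C. near F y x" using x(1) by blast
qed

text \<open>Vectors are now supports, and no nonzero element can stand in for the zero entries of
  \<open>homog y\<close>. The half-spaces instead compare entry \<open>j\<close> with the sum over
  the entries where \<open>homog y\<close> vanishes.\<close>

lemma mem_if_not_separated_Boolean:
  fixes C :: "('k ^ 'n::finite) set"
  assumes bool: "\<And>c::'k. c \<noteq> 0 \<Longrightarrow> c = 1" and C: "semimodule_convex C"
    and nonsep: "\<And>V W. (\<And>x. x \<in> C \<Longrightarrow> affine_form V x \<le> affine_form W x) \<Longrightarrow>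
      affine_form V y \<le> affine_form W y"
  shows "y \<in> C"
proof -
  have "\<exists>v\<in>cone_over C. v \<le> homog y \<and> z < v j" if z: "z < homog y j" for j z
  proof -
    have y: "homog y j \<noteq> 0" using z by (auto simp: less_le_not_le zero_least)
    have z0: "z = 0" using z bool[of z] bool[OF y] by auto
    define V W :: "'n option \<Rightarrow> 'k"
      where "V = (\<lambda>k. if k = j then 1 else 0)" and "W = (\<lambda>k. if homog y k = 0 then 1 else 0)"
    have V: "affine_form V x = homog x j" for x :: "'k ^ 'n"
      by (simp add: V_def affine_form_single)
    have "affine_form W y \<le> 0" by (auto simp: affine_form_le_iff W_def)
    hence "\<not> affine_form V y \<le> affine_form W y" using y by (auto simp: V idem_le_zero)
    then obtain x where x: "x \<in> C" "affine_form W x < homog x j"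
      using nonsep lin.not_le V by metis
    have xj: "homog x j \<noteq> 0" using x(2) by (auto simp: less_le_not_le zero_least)
    \<comment> \<open>Being strictly below an element of \<open>{0, 1}\<close> means being 0, so the
      support of \<open>homog x\<close> lies in that of \<open>homog y\<close>.\<close>
    have "affine_form W x = 0"
      by (rule ccontr) (use x(2) bool[OF xj] bool[of "affine_form W x"] in simp)
    hence W0: "W k * homog x k = 0" for k
      using affine_form_term[of W k x] by (simp add: idem_le_zero)
    have "homog x k \<le> homog y k" for k
      using W0[of k] bool[of "homog x k"] bool[of "homog y k"]
      by (cases "homog x k = 0") (auto simp: W_def zero_least split: if_splits)
    moreover have "homog x \<in> cone_over C"
      unfolding cone_over_def mem_Collect_eq
      using x(1) by (intro exI[of _ x] exI[of _ 1]) simp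
    ultimately show ?thesis using xj z0 by (auto simp: le_fun_def idem_zero_less)
  qed
  \<comment> \<open>The single threshold 0 determines the support, so \<open>v\<close> equals
    \<open>homog y\<close> exactly.\<close>
  then obtain v where v: "v \<in> cone_over C" "v \<le> homog y" "\<And>j. 0 < homog y j \<Longrightarrow> 0 < v j"
    using cone_over_approx[OF C, of "{0}" y "homog y"] by auto
  have vy: "v j = homog y j" for j
  proof (cases "homog y j = 0")
    case True
    thus ?thesis using v(2) by (metis idem_le_zero le_fun_def)
  next
    case False
    thus ?thesis using v(3)[of j] bool by (metis idem_zero_less)
  qed
  obtain x a where x: "x \<in> C" "v = (\<lambda>j. homog x j * a)" using v(1) by (auto simp: cone_over_def)
  have "a = 1" using vy[of None] by (simp add: x(2))
  hence "homog x = homog y" using vy by (auto simp: x(2))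
  thus ?thesis using x(1) homog_inject by metis
qed

lemma mem_if_not_separated:
  fixes C :: "('k ^ 'n::finite) set"
  assumes C: "semimodule_convex C" "order_closed C"
    and nonsep: "\<And>V W. (\<And>x. x \<in> C \<Longrightarrow> affine_form V x \<le> affine_form W x) \<Longrightarrow>
      affine_form V y \<le> affine_form W y"
  shows "y \<in> C"
proof (cases "\<exists>c::'k. c \<noteq> 0 \<and> c \<noteq> 1")
  case True
  then obtain c :: 'k where c: "c \<noteq> 0" "c \<noteq> 1" by blast
  \<comment> \<open>By totality, \<open>c\<close> or its inverse lies strictly below 1.\<close>
  consider "c < 1" | "sinv c < 1"
    using c sinv_mult_less_iff[of c 1 1] by (metis lin.linorder_cases mult.right_neutral)
  thus ?thesis
    using mem_if_not_separated_nontrivial[OF _ _ C nonsep] c(1) sinv_nonzero by cases blast+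
qed (use mem_if_not_separated_Boolean[OF _ C(1) nonsep] in blast)

end

theorem corollary4p7:
  fixes C :: "('k::cc_idempotent_semifield ^ 'n::finite) set"
  assumes ominus_exists:
    "\<And>\<nu> l :: 'k. \<exists>m. \<nu> \<le> l + m \<and> (\<forall>m'. \<nu> \<le> l + m' \<longrightarrow> m \<le> m')"
  shows "(semimodule_convex C \<and> order_closed C) \<longleftrightarrow> U_convex affine_differences C"
proof -
  interpret total_semifield "TYPE('k)"
    by standard (rule total_if_ominus_exists[OF ominus_exists])
  note sep_iff = U_convex_affine_differences_iff[OF ominus_exists, of C]
  show ?thesis
  proof
    assume C: "semimodule_convex C \<and> order_closed C"
    show "U_convex affine_differences C"
      unfolding sep_iff using C mem_if_not_separated[of C] by blast
  next
    assume "U_convex affine_differences C"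
    note sep = this[unfolded sep_iff]
    \<comment> \<open>Separation says that \<open>C\<close> is the intersection of the half-spaces
      containing it, and both properties pass to intersections.\<close>
    define \<X> where "\<X> = {X. C \<subseteq> X \<and> (\<exists>V W. X = {x. affine_form V x \<le> affine_form W x})}"
    have "C = \<Inter>\<X>"
    proof
      show "\<Inter>\<X> \<subseteq> C"
      proof (rule subsetI, rule ccontr)
        fix y assume y: "y \<in> \<Inter>\<X>" "y \<notin> C"
        then obtain V W where VW: "\<forall>x\<in>C. affine_form V x \<le> affine_form W x"
          "\<not> affine_form V y \<le> affine_form W y" using sep by blast
        hence "{x. affine_form V x \<le> affine_form W x} \<in> \<X>" by (auto simp: \<X>_def)
        thus False using y(1) VW(2) by blast
      qed
    qed (auto simp: \<X>_def)
    moreover have "semimodule_convex X" "order_closed X" if "X \<in> \<X>" for X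
      using that by (auto simp: \<X>_def semimodule_convex_halfspace order_closed_halfspace)
    ultimately show "semimodule_convex C \<and> order_closed C"
      using semimodule_convex_Inter order_closed_Inter by metis
  qed
qed

end
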